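(* Let $\mathbb{X},\mathbb{Y}$ be real polyhedral Banach spaces with $\dim(\mathbb{X})=n$ and $\dim(\mathbb{Y})=m$. Let $|Ext(B_{\mathbb{X}})|=2(n+p)$. If $mp<n+p$, then the pair $(\mathbb{X},\mathbb{Y})$ satisfies the weak L-P property.
   Context: All Banach spaces are real. $B_{\mathbb{X}}$ is the closed unit ball of $\mathbb{X}$ and $Ext(A)$ is the set of extreme points of a convex set $A$. A finite-dimensional Banach space is polyhedral if its closed unit ball has only finitely many extreme points. $\mathbb{L}(\mathbb{X},\mathbb{Y})$ is the space of bounded linear operators with the operator norm; an operator $T$ is an extreme contraction if it is an extreme point of the closed unit ball of $\mathbb{L}(\mathbb{X},\mathbb{Y})$. The pair $(\mathbb{X},\mathbb{Y})$ has the weak L-P property if for each extreme contraction $T\in\mathbb{L}(\mathbb{X},\mathbb{Y})$ with $\|T\|=1$ one has $T(Ext(B_{\mathbb{X}}))\cap Ext(B_{\mathbb{Y}})\neq\emptyset$. *)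

theory Defs
  imports "HOL-Analysis.Analysis"
begin

definition Ext :: "'a::real_vector set \<Rightarrow> 'a set" where
  "Ext A = {x. x extreme_point_of A}"

text \<open>A Banach space is a type of class \<^class>\<open>banach\<close>. The norm is arbitrary, so the class
  \<open>euclidean_space\<close> (whose norm comes from an inner product) is not suitable. Finite
  dimensionality is stated separately because \<open>dim UNIV\<close> is also \<open>0\<close> for
  an infinite-dimensional space.\<close>

definition finite_dimensional :: "'a::real_vector itself \<Rightarrow> bool" where
  "finite_dimensional _ \<longleftrightarrow> (\<exists>B::'a set. finite B \<and> span B = UNIV)"

definition polyhedral :: "'a::banach itself \<Rightarrow> bool" where
  "polyhedral _ \<longleftrightarrow> finite_dimensional TYPE('a) \<and> finite (Ext (cball (0::'a) 1))"

definition extreme_contraction :: "('a::banach \<Rightarrow>\<^sub>L 'b::banach) \<Rightarrow> bool" where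
  "extreme_contraction T \<longleftrightarrow> T \<in> Ext (cball 0 1)"

definition weak_LP :: "'a::banach itself \<Rightarrow> 'b::banach itself \<Rightarrow> bool" where
  "weak_LP _ _ \<longleftrightarrow>
     (\<forall>T::'a \<Rightarrow>\<^sub>L 'b. extreme_contraction T \<and> norm T = 1 \<longrightarrow>
        blinfun_apply T ` Ext (cball 0 1) \<inter> Ext (cball 0 1) \<noteq> {})"

end

theory Submission
  imports Defs
begin

text \<open>Suppose that no extreme point \<open>x\<close> of the ball of \<open>X\<close> is mapped by the extreme contraction \<open>T\<close>
  to an extreme point of the ball of \<open>Y\<close>. Then each \<open>x\<close> has some \<open>z x \<noteq> 0\<close> such that \<open>T x \<plusminus> z x\<close> lie in
  the ball of \<open>Y\<close>. Choose one of \<open>x\<close> and \<open>-x\<close> for each extreme point \<open>x\<close>; the resulting \<open>n + p\<close>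
  vectors contain a basis of \<open>X\<close>, so they satisfy \<open>p\<close> independent linear relations, and the existence of
  a linear \<open>A\<close> with \<open>A x = c x *\<^sub>R z x\<close> amounts to \<open>m * p\<close> homogeneous linear equations in the
  \<open>n + p\<close> unknowns \<open>c x\<close>. As \<open>m * p < n + p\<close>, there is a nonzero solution, which can be scaled so that
  \<open>\<bar>c x\<bar> \<le> 1\<close>. By Minkowski's theorem \<open>T + A\<close> and \<open>T - A\<close> are contractions, contradicting the
  extremality of \<open>T\<close>.\<close>

section \<open>Extreme points\<close>

text \<open>A point inside a segment is the midpoint of a shorter one. This symmetric form of
  extremality serves for vectors of either ball and for the operator \<open>T\<close> alike.\<close>

lemma extreme_point_of_iff_no_symmetric_segment:
  fixes x :: "'a::real_vector"
  assumes "convex K" "x \<in> K"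
  shows "x extreme_point_of K \<longleftrightarrow> (\<forall>z. x + z \<in> K \<and> x - z \<in> K \<longrightarrow> z = 0)"
proof
  assume ext: "x extreme_point_of K"
  show "\<forall>z. x + z \<in> K \<and> x - z \<in> K \<longrightarrow> z = 0"
  proof (intro allI impI)
    fix z assume z: "x + z \<in> K \<and> x - z \<in> K"
    show "z = 0"
    proof (rule ccontr)
      assume "z \<noteq> 0"
      have "x \<in> open_segment (x - z) (x + z)"
        unfolding in_segment
      proof (intro conjI exI[of _ "1/2::real"])
        show "x - z \<noteq> x + z"
        proof
          assume "x - z = x + z"
          then have "2 *\<^sub>R z = 0" by (simp add: scaleR_2 algebra_simps)
          with \<open>z \<noteq> 0\<close> show False by simp
        qed
        have "(1/2) *\<^sub>R x + (1/2) *\<^sub>R x = x"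
          by (simp flip: scaleR_left_distrib)
        then show "x = (1 - 1/2) *\<^sub>R (x - z) + (1/2) *\<^sub>R (x + z)"
          by (simp add: algebra_simps)
      qed auto
      with ext z show False unfolding extreme_point_of_def by blast
    qed
  qed
next
  assume R: "\<forall>z. x + z \<in> K \<and> x - z \<in> K \<longrightarrow> z = 0"
  show "x extreme_point_of K"
    unfolding extreme_point_of_def
  proof (intro conjI ballI notI)
    fix a b assume ab: "a \<in> K" "b \<in> K" "x \<in> open_segment a b"
    then obtain u where u: "0 < u" "u < 1" "x = (1 - u) *\<^sub>R a + u *\<^sub>R b" and "a \<noteq> b"
      unfolding in_segment by blast
    \<comment> \<open>This is the distance from \<open>u\<close> to the nearer end of [0,1], so both
      \<open>u + e\<close> and \<open>u - e\<close> are still convex weights.\<close>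
    define e where "e = min u (1 - u)"
    have e: "0 < e" "e \<le> u" "e \<le> 1 - u" using u by (auto simp: e_def)
    have "x + e *\<^sub>R (b - a) = (1 - (u + e)) *\<^sub>R a + (u + e) *\<^sub>R b"
      using u by (simp add: algebra_simps)
    moreover have "x - e *\<^sub>R (b - a) = (1 - (u - e)) *\<^sub>R a + (u - e) *\<^sub>R b"
      using u by (simp add: algebra_simps)
    ultimately have "x + e *\<^sub>R (b - a) \<in> K" "x - e *\<^sub>R (b - a) \<in> K"
      using e u ab \<open>convex K\<close> by (auto intro!: convexD_alt)
    then have "e *\<^sub>R (b - a) = 0" using R by blast
    with e \<open>a \<noteq> b\<close> show False by simp
  qed (use assms in auto)
qed

text \<open>For convex \<open>K\<close> and \<open>x\<close> in \<open>K\<close>, this is the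
  direction space of the smallest face containing \<open>x\<close>. Leaving the scale
  \<open>e\<close> free for each direction is what makes it a subspace.\<close>

definition face_directions :: "'a::real_vector set \<Rightarrow> 'a \<Rightarrow> 'a set" where
  "face_directions K x = {v. \<exists>e>0. x + e *\<^sub>R v \<in> K \<and> x - e *\<^sub>R v \<in> K}"

lemma convex_add_scaleR_mono:
  fixes x :: "'a::real_vector"
  assumes "convex K" "x \<in> K" "x + e *\<^sub>R v \<in> K" "0 \<le> d" "d \<le> e"
  shows "x + d *\<^sub>R v \<in> K"
proof (cases "e = 0")
  case False
  with assms have e: "e > 0" by simp
  have "(1 - d/e) *\<^sub>R x + (d/e) *\<^sub>R (x + e *\<^sub>R v) \<in> K"
    using assms e by (intro convexD_alt) auto
  then show ?thesis using e by (simp add: algebra_simps)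
qed (use assms in auto)

lemma subspace_face_directions:
  assumes K: "convex K" and x: "x \<in> K"
  shows "subspace (face_directions K x)"
  unfolding subspace_def
proof (intro conjI ballI allI)
  show "0 \<in> face_directions K x" using x by (auto simp: face_directions_def intro!: exI[of _ 1])
next
  fix v w assume "v \<in> face_directions K x" "w \<in> face_directions K x"
  then obtain d e where d: "d > 0" "x + d *\<^sub>R v \<in> K" "x + d *\<^sub>R (- v) \<in> K"
    and e: "e > 0" "x + e *\<^sub>R w \<in> K" "x + e *\<^sub>R (- w) \<in> K"
    by (auto simp: face_directions_def)
  \<comment> \<open>A common scale for both directions; averaging the endpoints then realises
    \<open>v + w\<close> at scale \<open>r/2\<close>.\<close>
  define r where "r = min d e"
  have r: "r > 0" "r \<le> d" "r \<le> e" using d e by (auto simp: r_def)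
  have "x + r *\<^sub>R v \<in> K" "x + r *\<^sub>R (-v) \<in> K" "x + r *\<^sub>R w \<in> K" "x + r *\<^sub>R (-w) \<in> K"
    using convex_add_scaleR_mono[OF K x] d e r by (meson less_imp_le)+
  then have *: "(1 - 1/2) *\<^sub>R (x + r *\<^sub>R v) + (1/2) *\<^sub>R (x + r *\<^sub>R w) \<in> K"
      "(1 - 1/2) *\<^sub>R (x + r *\<^sub>R (-v)) + (1/2) *\<^sub>R (x + r *\<^sub>R (-w)) \<in> K"
    by (intro convexD_alt[OF K]; simp)+
  have h: "(1/2) *\<^sub>R x + (1/2) *\<^sub>R x = x" by (simp flip: scaleR_left_distrib)
  have "(1 - 1/2) *\<^sub>R (x + r *\<^sub>R v) + (1/2) *\<^sub>R (x + r *\<^sub>R w) = ((1/2) *\<^sub>R x + (1/2) *\<^sub>R x) + (r/2) *\<^sub>R (v + w)"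
     "(1 - 1/2) *\<^sub>R (x + r *\<^sub>R (-v)) + (1/2) *\<^sub>R (x + r *\<^sub>R (-w)) = ((1/2) *\<^sub>R x + (1/2) *\<^sub>R x) - (r/2) *\<^sub>R (v + w)"
    by (simp_all add: algebra_simps)
  with * r show "v + w \<in> face_directions K x"
    unfolding h face_directions_def by (auto intro!: exI[of _ "r/2"])
next
  fix c v assume "v \<in> face_directions K x"
  then obtain d where d: "d > 0" "x + d *\<^sub>R v \<in> K" "x - d *\<^sub>R v \<in> K"
    by (auto simp: face_directions_def)
  show "c *\<^sub>R v \<in> face_directions K x"
  proof (cases "c = 0")
    case True
    then show ?thesis using x by (auto simp: face_directions_def intro!: exI[of _ 1])
  next
    case False
    \<comment> \<open>A negative \<open>c\<close> only swaps the two endpoints.\<close>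
    then have "(d/\<bar>c\<bar>) *\<^sub>R (c *\<^sub>R v) = d *\<^sub>R v \<or> (d/\<bar>c\<bar>) *\<^sub>R (c *\<^sub>R v) = - (d *\<^sub>R v)"
      by (cases "c > 0") auto
    with d False show ?thesis
      unfolding face_directions_def by (auto intro!: exI[of _ "d/\<bar>c\<bar>"])
  qed
qed

text \<open>Contracting towards \<open>z\<close> by the factor \<open>1 - u\<close> carries a
  segment centred at \<open>y\<close> to one centred at the combination; \<open>u < 1\<close> keeps
  its length positive.\<close>

lemma face_directions_mono:
  assumes K: "convex K" and yz: "y \<in> K" "z \<in> K" and u: "0 \<le> u" "u < 1"
  shows "face_directions K y \<subseteq> face_directions K ((1 - u) *\<^sub>R y + u *\<^sub>R z)"
proof
  fix w assume "w \<in> face_directions K y"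
  then obtain e where e: "e > 0" "y + e *\<^sub>R w \<in> K" "y - e *\<^sub>R w \<in> K"
    by (auto simp: face_directions_def)
  have "(1 - u) *\<^sub>R (y + e *\<^sub>R w) + u *\<^sub>R z \<in> K" "(1 - u) *\<^sub>R (y - e *\<^sub>R w) + u *\<^sub>R z \<in> K"
    using e yz u by (auto intro!: convexD_alt[OF K])
  then show "w \<in> face_directions K ((1 - u) *\<^sub>R y + u *\<^sub>R z)"
    using e u unfolding face_directions_def
    by (auto intro!: exI[of _ "(1 - u) * e"] simp: algebra_simps)
qed

text \<open>The admissible parameters form a nonempty compact set, bounded because \<open>v\<close>
  is nonzero, so they have a maximum.\<close>

lemma last_point_on_ray:
  fixes x :: "'a::real_normed_vector"
  assumes "closed K" "bounded K" "x \<in> K" "v \<noteq> 0"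
  obtains t where "0 \<le> t" "x + t *\<^sub>R v \<in> K" "\<And>s. t < s \<Longrightarrow> x + s *\<^sub>R v \<notin> K"
proof -
  define S where "S = {t. 0 \<le> t \<and> x + t *\<^sub>R v \<in> K}"
  have S: "S = {0..} \<inter> (\<lambda>t. x + t *\<^sub>R v) -` K" by (auto simp: S_def)
  have "closed S"
    unfolding S by (intro closed_Int closed_vimage assms continuous_intros closed_atLeast)
  moreover have "bounded S"
  proof -
    obtain C where C: "\<And>y. y \<in> K \<Longrightarrow> norm y \<le> C"
      using \<open>bounded K\<close> by (auto simp: bounded_iff)
    have "\<bar>t\<bar> \<le> (2 * C) / norm v" if "t \<in> S" for t
    proof -
      have "norm (t *\<^sub>R v) \<le> norm (x + t *\<^sub>R v) + norm x"
        using norm_triangle_ineq4[of "x + t *\<^sub>R v" x] by simp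
      also have "\<dots> \<le> C + C"
        using that \<open>x \<in> K\<close> by (intro add_mono C) (auto simp: S_def)
      finally show ?thesis using \<open>v \<noteq> 0\<close> by (simp add: field_simps)
    qed
    then show ?thesis unfolding bounded_iff by (metis real_norm_def)
  qed
  ultimately have "compact S" by (simp add: compact_eq_bounded_closed)
  moreover have "S \<noteq> {}" using \<open>x \<in> K\<close> by (auto simp: S_def intro!: exI[of _ 0])
  ultimately obtain t where t: "t \<in> S" "\<forall>s\<in>S. s \<le> t"
    using compact_attains_sup by blast
  show thesis
  proof
    show "0 \<le> t" "x + t *\<^sub>R v \<in> K" using t(1) by (auto simp: S_def)
    fix s assume "t < s"
    then have "s \<notin> S" using t(2) by (auto simp: not_le)
    then show "x + s *\<^sub>R v \<notin> K" using \<open>t < s\<close> \<open>0 \<le> t\<close> by (simp add: S_def)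
  qed
qed

section \<open>Finite dimension and Minkowski's theorem\<close>

lemma finite_dimensional_basis:
  assumes "finite_dimensional TYPE('a::real_vector)"
  obtains B :: "'a::real_vector set" where "finite B" "independent B" "span B = UNIV"
    "card B = dim (UNIV :: 'a set)"
proof -
  obtain S :: "'a set" where S: "finite S" "span S = UNIV"
    using assms by (auto simp: finite_dimensional_def)
  obtain B :: "'a set" where B: "independent B" "UNIV \<subseteq> span B" "card B = dim (UNIV :: 'a set)"
    using basis_exists[of UNIV] by metis
  then have "finite B"
    using real_vector.independent_span_bound[OF S(1) B(1)] S by auto
  then show thesis using that B by blast
qed

lemma dim_psubset_subspace:
  fixes U V :: "'a::real_vector set"
  assumes "finite_dimensional TYPE('a)" "subspace U" "subspace V" "U \<subset> V"
  shows "dim U < dim V"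
proof -
  obtain B :: "'a set" where B: "finite B" "independent B" "span B = UNIV"
    using finite_dimensional_basis[OF assms(1)] by metis
  \<comment> \<open>The basis gives access to strict monotonicity of dimension; the raw definitions
    identify the locale's constants with \<open>dim\<close> and \<open>span\<close>.\<close>
  interpret F: finite_dimensional_vector_space "scaleR :: real \<Rightarrow> 'a \<Rightarrow> 'a" B
    using B by unfold_locales (simp_all flip: dependent_raw_def span_raw_def)
  have "span U \<subset> span V"
    using assms(2-4) by (simp add: span_eq_iff[THEN iffD2])
  then show ?thesis
    using F.dim_psubset[of U V] by (simp only: dim_raw_def span_raw_def)
qed

text \<open>Minkowski's theorem. The library has it only for Euclidean spaces. The induction is on the
  dimension of the smallest face that contains \<open>x\<close>: moving from \<open>x\<close> along a direction \<open>v\<close> of this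
  face in both ways until leaving \<open>K\<close> reaches two points whose faces no longer contain \<open>v\<close>.\<close>

lemma subset_convex_hull_Ext:
  fixes K :: "'a::real_normed_vector set"
  assumes fd: "finite_dimensional TYPE('a)" and K: "convex K" "closed K" "bounded K"
  shows "K \<subseteq> convex hull (Ext K)"
proof
  fix x assume "x \<in> K"
  then show "x \<in> convex hull (Ext K)"
  proof (induction "dim (face_directions K x)" arbitrary: x rule: less_induct)
    case less
    show ?case
    proof (cases "x extreme_point_of K")
      case True
      then show ?thesis by (simp add: Ext_def hull_inc)
    next
      case False
      then obtain v where v: "v \<noteq> 0" "x + v \<in> K" "x - v \<in> K"
        using extreme_point_of_iff_no_symmetric_segment[OF K(1) less.prems] by blast
      then have vD: "v \<in> face_directions K x"
        by (auto simp: face_directions_def intro!: exI[of _ 1])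
      obtain t where t: "0 \<le> t" "x + t *\<^sub>R v \<in> K" "\<And>s. t < s \<Longrightarrow> x + s *\<^sub>R v \<notin> K"
        using last_point_on_ray[OF K(2,3) less.prems v(1)] by metis
      obtain s where s: "0 \<le> s" "x + s *\<^sub>R (-v) \<in> K" "\<And>r. s < r \<Longrightarrow> x + r *\<^sub>R (-v) \<notin> K"
        using last_point_on_ray[OF K(2,3) less.prems, of "-v"] v(1) by (metis neg_equal_0_iff_equal)
      have t1: "t \<ge> 1" using t(3)[of 1] v by fastforce
      have s1: "s \<ge> 1" using s(3)[of 1] v by fastforce
      define y where "y = x + t *\<^sub>R v"
      define z where "z = x + s *\<^sub>R (-v)"
      have yz: "y \<in> K" "z \<in> K" using s t by (auto simp: y_def z_def)
      \<comment> \<open>The weight for which the displacements of \<open>y\<close> and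
        \<open>z\<close> along \<open>v\<close> cancel, leaving \<open>x\<close>.\<close>
      define u where "u = t / (s + t)"
      have u: "0 < u" "u < 1" using s1 t1 by (auto simp: u_def)
      have "(1 - u) * t = u * s" using s1 t1 by (simp add: u_def field_simps)
      moreover have "(1 - u) *\<^sub>R y + u *\<^sub>R z = x + ((1 - u) * t - u * s) *\<^sub>R v"
        by (simp add: y_def z_def algebra_simps)
      ultimately have x: "x = (1 - u) *\<^sub>R y + u *\<^sub>R z" by simp
      then have x': "x = (1 - (1 - u)) *\<^sub>R z + (1 - u) *\<^sub>R y" by (simp add: algebra_simps)
      \<comment> \<open>Since \<open>y\<close> is the last point of \<open>K\<close> along
        \<open>v\<close>, this direction is lost, and the dimension drops strictly.\<close>
      have "v \<notin> face_directions K y"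
      proof
        assume "v \<in> face_directions K y"
        then obtain e where "e > 0" "y + e *\<^sub>R v \<in> K" by (auto simp: face_directions_def)
        then show False using t(3)[of "t + e"] by (simp add: y_def algebra_simps)
      qed
      moreover have "face_directions K y \<subseteq> face_directions K x"
        using face_directions_mono[OF K(1) yz] u x by simp
      ultimately have "dim (face_directions K y) < dim (face_directions K x)"
        using vD yz less.prems K(1) by (intro dim_psubset_subspace fd subspace_face_directions) auto
      then have yh: "y \<in> convex hull (Ext K)" using less.hyps yz by blast
      have "v \<notin> face_directions K z"
      proof
        assume "v \<in> face_directions K z"
        then obtain e where "e > 0" "z - e *\<^sub>R v \<in> K" by (auto simp: face_directions_def)
        then show False using s(3)[of "s + e"] by (simp add: z_def algebra_simps)
      qed
      moreover have "face_directions K z \<subseteq> face_directions K x"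
        using face_directions_mono[OF K(1) yz(2,1), of "1 - u"] u x' by simp
      ultimately have "dim (face_directions K z) < dim (face_directions K x)"
        using vD yz less.prems K(1) by (intro dim_psubset_subspace fd subspace_face_directions) auto
      then have "z \<in> convex hull (Ext K)" using less.hyps yz by blast
      with yh show ?thesis
        unfolding x using u by (intro convexD_alt convex_convex_hull) auto
    qed
  qed
qed

section \<open>Extreme points of the unit ball\<close>

lemma span_Ext_cball:
  assumes "finite_dimensional TYPE('a::real_normed_vector)"
  shows "span (Ext (cball (0::'a::real_normed_vector) 1)) = UNIV"
proof -
  have "x \<in> span (Ext (cball 0 1))" for x :: 'a
  proof (cases "x = 0")
    case True
    then show ?thesis by (simp add: span_zero)
  next
    case False
    have "(1 / norm x) *\<^sub>R x \<in> cball 0 1" using False by simp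
    then have "(1 / norm x) *\<^sub>R x \<in> convex hull (Ext (cball 0 1))"
      using subset_convex_hull_Ext[OF assms] by blast
    then have "(1 / norm x) *\<^sub>R x \<in> span (Ext (cball 0 1))"
      using convex_hull_subset_span by blast
    then have "norm x *\<^sub>R ((1 / norm x) *\<^sub>R x) \<in> span (Ext (cball 0 1))"
      by (rule span_scale)
    then show ?thesis using False by simp
  qed
  then show ?thesis by blast
qed

text \<open>The preimage of a ball under \<open>A\<close> is convex, so containing the extreme
  points it contains the unit ball by Minkowski; homogeneity does the rest.\<close>

lemma norm_linear_le_of_Ext:
  fixes A :: "'a::real_normed_vector \<Rightarrow> 'b::real_normed_vector"
  assumes fd: "finite_dimensional TYPE('a)" and A: "linear A"
    and C: "\<And>x. x \<in> Ext (cball 0 1) \<Longrightarrow> norm (A x) \<le> C"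
  shows "norm (A x) \<le> C * norm x"
proof (cases "x = 0")
  case True
  then show ?thesis using A by (simp add: linear_0)
next
  case False
  have "convex (A -` cball 0 C)" by (intro convex_linear_vimage A convex_cball)
  moreover have "Ext (cball 0 1) \<subseteq> A -` cball 0 C" using C by auto
  ultimately have "convex hull (Ext (cball 0 1)) \<subseteq> A -` cball 0 C" by (rule hull_minimal[rotated])
  moreover have "(1 / norm x) *\<^sub>R x \<in> cball 0 1" using False by simp
  then have "(1 / norm x) *\<^sub>R x \<in> convex hull (Ext (cball 0 1))"
    using subset_convex_hull_Ext[OF fd] by blast
  ultimately have "norm (A ((1 / norm x) *\<^sub>R x)) \<le> C" by auto
  then show ?thesis using False by (simp add: linear_scale[OF A] field_simps)
qed

lemma uminus_mem_Ext_cball: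
  fixes x :: "'a::real_normed_vector"
  assumes "x \<in> Ext (cball 0 1)"
  shows "- x \<in> Ext (cball 0 1)"
proof -
  have x: "x \<in> cball 0 1" using assms by (auto simp: Ext_def extreme_point_of_def)
  have "\<forall>z. x + z \<in> cball 0 1 \<and> x - z \<in> cball 0 1 \<longrightarrow> z = 0"
    using assms extreme_point_of_iff_no_symmetric_segment[OF convex_cball x]
    by (simp add: Ext_def)
  moreover have "norm (- x + z) = norm (x - z)" "norm (- x - z) = norm (x + z)" for z
    using norm_minus_cancel[of "x - z"] norm_minus_cancel[of "x + z"] by (simp_all add: algebra_simps)
  ultimately show ?thesis
    using x extreme_point_of_iff_no_symmetric_segment[OF convex_cball, of "- x" 0 1]
    by (simp add: Ext_def)
qed

text \<open>Every \<open>z\<close> in the ball makes 0 the midpoint of \<open>z\<close> and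
  \<open>-z\<close>, so only the trivial space is possible.\<close>

lemma zero_mem_Ext_cball_imp:
  assumes "0 \<in> Ext (cball (0::'a::real_normed_vector) 1)"
  shows "Ext (cball (0::'a::real_normed_vector) 1) = {0}"
proof -
  have "\<forall>z::'a. z \<in> cball 0 1 \<longrightarrow> z = 0"
    using assms extreme_point_of_iff_no_symmetric_segment[OF convex_cball, of "0::'a" 0 1]
    by (simp add: Ext_def)
  then show ?thesis using assms by (auto simp: Ext_def extreme_point_of_def)
qed

section \<open>Linear algebra\<close>

lemma symmetric_set_half:
  fixes E :: "'a::real_vector set"
  assumes "finite E" "\<And>x. x \<in> E \<Longrightarrow> - x \<in> E" "0 \<notin> E"
  obtains F where "F \<subseteq> E" "E = F \<union> uminus ` F" "card E = 2 * card F"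
proof -
  \<comment> \<open>Choosing from the unordered pair guarantees that \<open>x\<close> and
    \<open>-x\<close> get the same representative.\<close>
  define f where "f x = (SOME y. y \<in> {x, - x})" for x :: 'a
  define F where "F = f ` E"
  have f: "f x = x \<or> f x = - x" for x
  proof -
    have "f x \<in> {x, - x}" unfolding f_def by (rule someI[of _ x]) simp
    then show ?thesis by blast
  qed
  have fm: "f (- x) = f x" for x by (simp add: f_def insert_commute)
  have FE: "F \<subseteq> E" using f assms(2) unfolding F_def by (metis image_subsetI)
  have un: "E = F \<union> uminus ` F"
  proof
    show "E \<subseteq> F \<union> uminus ` F"
    proof
      fix x assume "x \<in> E"
      then have "f x \<in> F" by (simp add: F_def)
      then show "x \<in> F \<union> uminus ` F"
        using f[of x] by (metis UnI1 UnI2 image_eqI minus_minus)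
    qed
    show "F \<union> uminus ` F \<subseteq> E" using FE assms(2) by auto
  qed
  have "F \<inter> uminus ` F = {}"
  proof (rule ccontr)
    assume "F \<inter> uminus ` F \<noteq> {}"
    then obtain x y where xy: "x \<in> E" "y \<in> E" "f x = - f y" by (auto simp: F_def)
    then have "x = y \<or> x = - y" using f[of x] f[of y] by auto
    then have "f x = f y" using fm by auto
    with xy(3) have "f x + f x = 0" by (metis add.left_inverse)
    then have "2 *\<^sub>R f x = 0" by (simp add: scaleR_2)
    then have "x = 0" using f[of x] by auto
    with xy assms show False by simp
  qed
  then have "card E = card F + card (uminus ` F)"
    using FE assms(1) un by (metis card_Un_disjoint finite_Un)
  moreover have "card (uminus ` F) = card F" by (simp add: card_image)
  ultimately show thesis using that FE un by simp
qed

section \<open>Homogeneous linear systems\<close>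

lemma homogeneous_system_nontrivial:
  fixes a :: "'j \<Rightarrow> 'i \<Rightarrow> 'k::field"
  assumes "finite J" "finite I" "card J < card I"
  shows "\<exists>c. (\<exists>i\<in>I. c i \<noteq> 0) \<and> (\<forall>j\<in>J. (\<Sum>i\<in>I. a j i * c i) = 0)"
  using assms
proof (induction J arbitrary: I a rule: finite_induct)
  case empty
  then have "I \<noteq> {}" by auto
  then show ?case by (intro exI[of _ "\<lambda>_. 1"]) auto
next
  case (insert j J)
  show ?case
  proof (cases "\<forall>i\<in>I. a j i = 0")
    case True
    have "card J < card I" using insert by simp
    with insert.IH[of I a] insert.prems True show ?thesis by auto
  next
    case False
    then obtain k where k: "k \<in> I" "a j k \<noteq> 0" by blast
    \<comment> \<open>Gaussian elimination: equation \<open>j\<close> is used to eliminate the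
      unknown \<open>k\<close>.\<close>
    define a' where "a' l i = a l i - a l k * (a j i / a j k)" for l i
    have "finite (I - {k})" "card J < card (I - {k})"
      using insert k by (auto simp: card_Diff_singleton)
    from insert.IH[OF this, of a'] obtain c where c: "\<exists>i\<in>I - {k}. c i \<noteq> 0"
      "\<And>l. l \<in> J \<Longrightarrow> (\<Sum>i\<in>I - {k}. a' l i * c i) = 0" by blast
    \<comment> \<open>The value that equation \<open>j\<close> forces on the unknown
      \<open>k\<close>.\<close>
    define d where "d = - (\<Sum>i\<in>I - {k}. a j i / a j k * c i)"
    have sum_d: "(\<Sum>i\<in>I. a l i * (c(k := d)) i) = (\<Sum>i\<in>I - {k}. a' l i * c i)" for l
    proof -
      have "(\<Sum>i\<in>I. a l i * (c(k := d)) i) = a l k * d + (\<Sum>i\<in>I - {k}. a l i * (c(k := d)) i)"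
        using sum.remove[OF insert.prems(1) k(1), of "\<lambda>i. a l i * (c(k := d)) i"] by simp
      also have "(\<Sum>i\<in>I - {k}. a l i * (c(k := d)) i) = (\<Sum>i\<in>I - {k}. a l i * c i)"
        by (intro sum.cong) auto
      also have "a l k * d + \<dots> = (\<Sum>i\<in>I - {k}. a' l i * c i)"
        by (simp add: d_def a'_def sum_distrib_left sum_subtractf left_diff_distrib mult.assoc)
      finally show ?thesis .
    qed
    have "a' j i = 0" for i using k by (simp add: a'_def)
    then have "\<forall>l\<in>insert j J. (\<Sum>i\<in>I. a l i * (c(k := d)) i) = 0"
      using c(2) by (auto simp only: sum_d) simp_all
    moreover have "\<exists>i\<in>I. (c(k := d)) i \<noteq> 0" using c(1) by auto
    ultimately show ?thesis by blast
  qed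
qed

text \<open>Coordinates in a basis split each vector equation into \<open>dim UNIV\<close> scalar
  equations, indexed by \<open>J \<times> B\<close>.\<close>

lemma homogeneous_vector_system_nontrivial:
  fixes w :: "'j \<Rightarrow> 'i \<Rightarrow> 'b::real_vector"
  assumes fd: "finite_dimensional TYPE('b)" and fin: "finite J" "finite I"
    and card: "dim (UNIV :: 'b set) * card J < card I"
  shows "\<exists>c. (\<exists>i\<in>I. c i \<noteq> 0) \<and> (\<forall>j\<in>J. (\<Sum>i\<in>I. c i *\<^sub>R w j i) = 0)"
proof -
  obtain B :: "'b set" where B: "finite B" "independent B" "span B = UNIV" "card B = dim (UNIV :: 'b set)"
    using finite_dimensional_basis[OF fd] by metis
  have "finite (J \<times> B)" "card (J \<times> B) < card I"
    using B fin card by (auto simp: card_cartesian_product mult.commute)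
  from homogeneous_system_nontrivial[OF this(1) fin(2) this(2),
      of "\<lambda>q i. representation B (w (fst q) i) (snd q)"]
  obtain c where c: "\<exists>i\<in>I. c i \<noteq> 0"
    "\<forall>q\<in>J \<times> B. (\<Sum>i\<in>I. representation B (w (fst q) i) (snd q) * c i) = 0" by blast
  have "(\<Sum>i\<in>I. c i *\<^sub>R w j i) = 0" if j: "j \<in> J" for j
  proof -
    let ?v = "\<Sum>i\<in>I. c i *\<^sub>R w j i"
    have "representation B ?v b = 0" if "b \<in> B" for b
    proof -
      have "representation B ?v b = (\<Sum>i\<in>I. c i * representation B (w j i) b)"
        using B by (simp add: real_vector.representation_sum real_vector.representation_scale)
      also have "\<dots> = 0" using c(2) j that by (auto simp: mult.commute dest!: bspec[of _ _ "(j, b)"])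
      finally show ?thesis .
    qed
    moreover have "(\<Sum>b\<in>B. representation B ?v b *\<^sub>R b) = ?v"
      using B by (intro real_vector.sum_representation_eq) auto
    ultimately show ?thesis by simp
  qed
  with c(1) show ?thesis by blast
qed

text \<open>A basis \<open>B\<close> inside \<open>F\<close> determines \<open>A\<close>; each
  element of \<open>F - B\<close> then imposes one vector equation on the coefficients
  \<open>c\<close>.\<close>

lemma exists_linear_prescribed_directions:
  fixes F :: "'a::real_vector set" and z :: "'a \<Rightarrow> 'b::real_vector"
  assumes fd: "finite_dimensional TYPE('b)" and F: "finite F" "span F = UNIV"
    and card: "dim (UNIV :: 'b set) * (card F - dim (UNIV :: 'a set)) < card F"
  obtains A c where "linear A" "\<And>x. x \<in> F \<Longrightarrow> A x = c x *\<^sub>R z x" "\<exists>x\<in>F. c x \<noteq> (0::real)"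
proof -
  obtain B where B: "B \<subseteq> F" "independent B" "F \<subseteq> span B" "card B = dim F"
    using basis_exists by metis
  have finB: "finite B" using B F finite_subset by blast
  have dimF: "dim F = dim (UNIV :: 'a set)" using dim_span[of F] F by simp
  have spB: "span B = UNIV" using span_minimal[OF B(3) subspace_span] F(2) by blast
  have "card (F - B) = card F - dim (UNIV :: 'a set)"
    using B finB dimF by (simp add: card_Diff_subset)
  with card have card': "dim (UNIV :: 'b set) * card (F - B) < card F" by simp
  text \<open>\<open>\<rho> j\<close> holds the coefficients of the linear relation expressing \<open>j\<close> in the basis \<open>B\<close>.\<close>
  define \<rho> :: "'a \<Rightarrow> 'a \<Rightarrow> real" where
    "\<rho> j i = (if i \<in> B then representation B j i else if i = j then - 1 else 0)" for j i
  \<comment> \<open>Equation \<open>j\<close> says that the value at \<open>j\<close> forced by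
    those on \<open>B\<close> is \<open>c j *\<^sub>R z j\<close>; the entry \<open>-1\<close> moves
    this term to the left.\<close>
  obtain c where c: "\<exists>i\<in>F. c i \<noteq> 0" "\<forall>j\<in>F - B. (\<Sum>i\<in>F. c i *\<^sub>R (\<rho> j i *\<^sub>R z i)) = 0"
    using homogeneous_vector_system_nontrivial[OF fd _ F(1) card', of "\<lambda>j i. \<rho> j i *\<^sub>R z i"] F
    by auto
  obtain A where A: "linear A" "\<forall>x\<in>B. A x = c x *\<^sub>R z x"
    using linear_independent_extend[OF B(2), of "\<lambda>x. c x *\<^sub>R z x"] by blast
  have "A j = c j *\<^sub>R z j" if j: "j \<in> F" for j
  proof (cases "j \<in> B")
    case False
    have "j = (\<Sum>b\<in>B. representation B j b *\<^sub>R b)"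
      using real_vector.sum_representation_eq[OF B(2) _ finB order_refl, of j] spB by simp
    then have "A j = (\<Sum>b\<in>B. representation B j b *\<^sub>R A b)"
      by (metis (no_types, lifting) A(1) linear_scale linear_sum sum.cong)
    also have "\<dots> = (\<Sum>b\<in>B. c b *\<^sub>R (\<rho> j b *\<^sub>R z b))"
      using A(2) by (intro sum.cong) (auto simp: \<rho>_def)
    finally have Aj: "A j = (\<Sum>b\<in>B. c b *\<^sub>R (\<rho> j b *\<^sub>R z b))" .
    have "(\<Sum>i\<in>F - B. c i *\<^sub>R (\<rho> j i *\<^sub>R z i)) = (\<Sum>i\<in>{j}. c i *\<^sub>R (\<rho> j i *\<^sub>R z i))"
      using j False F by (intro sum.mono_neutral_right) (auto simp: \<rho>_def)
    also have "\<dots> = - (c j *\<^sub>R z j)" using False by (simp add: \<rho>_def)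
    finally have "(\<Sum>i\<in>F. c i *\<^sub>R (\<rho> j i *\<^sub>R z i)) = - (c j *\<^sub>R z j) + A j"
      using sum.subset_diff[OF B(1) F(1), of "\<lambda>i. c i *\<^sub>R (\<rho> j i *\<^sub>R z i)"] Aj by simp
    with c(2) j False show ?thesis by simp
  qed (use A in auto)
  with A c that show thesis by blast
qed

section \<open>Perturbing an extreme contraction\<close>

theorem theorem2p5:
  fixes n m p :: nat
  assumes "polyhedral TYPE('a::banach)" and "polyhedral TYPE('b::banach)"
    and "dim (UNIV :: 'a set) = n" and "dim (UNIV :: 'b set) = m"
    and "card (Ext (cball (0::'a) 1)) = 2 * (n + p)"
    and "m * p < n + p"
  shows "weak_LP TYPE('a) TYPE('b)"
  unfolding weak_LP_def
proof (intro allI impI notI)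
  fix T :: "'a \<Rightarrow>\<^sub>L 'b"
  let ?E = "Ext (cball (0::'a) 1)"
  assume "extreme_contraction T \<and> norm T = 1" and disj: "blinfun_apply T ` ?E \<inter> Ext (cball 0 1) = {}"
  then have T: "T extreme_point_of cball 0 1" "norm T = 1"
    by (auto simp: extreme_contraction_def Ext_def)
  have fda: "finite_dimensional TYPE('a)" and fdb: "finite_dimensional TYPE('b)" and finE: "finite ?E"
    using assms(1,2) by (auto simp: polyhedral_def)
  \<comment> \<open>If 0 were extreme, it would be the only extreme point, against the even
    cardinality.\<close>
  have "0 \<notin> ?E"
  proof
    assume "0 \<in> ?E"
    then have "card ?E = 1" by (simp add: zero_mem_Ext_cball_imp)
    with assms(5) show False by presburger
  qed
  then obtain F where F: "F \<subseteq> ?E" "?E = F \<union> uminus ` F" "card ?E = 2 * card F"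
    using symmetric_set_half[OF finE] uminus_mem_Ext_cball by metis
  have finF: "finite F" using F(1) finE finite_subset by blast
  have cardF: "card F = n + p" using F(3) assms(5) by simp
  have "?E \<subseteq> span F" using F(2) by (auto intro: span_base span_neg)
  then have spF: "span F = UNIV"
    using span_Ext_cball[OF fda] span_minimal[of ?E "span F"] by auto
  have "\<exists>z. z \<noteq> 0 \<and> norm (T x + z) \<le> 1 \<and> norm (T x - z) \<le> 1" if "x \<in> F" for x
  proof -
    have xE: "x \<in> ?E" using that F by auto
    then have "norm x \<le> 1" by (auto simp: Ext_def extreme_point_of_def)
    then have "T x \<in> cball 0 1" using norm_blinfun[of T x] T(2) by simp
    moreover have "\<not> T x extreme_point_of cball 0 1" using disj xE by (auto simp: Ext_def)
    ultimately show ?thesis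
      using extreme_point_of_iff_no_symmetric_segment[OF convex_cball, of "T x" 0 1] by auto
  qed
  then obtain z where z: "\<And>x. x \<in> F \<Longrightarrow> z x \<noteq> 0" "\<And>x. x \<in> F \<Longrightarrow> norm (T x + z x) \<le> 1"
    "\<And>x. x \<in> F \<Longrightarrow> norm (T x - z x) \<le> 1" by metis
  \<comment> \<open>The difference is \<open>(n + p) - n = p\<close>, so this is the hypothesis
    \<open>m * p < n + p\<close>.\<close>
  have "dim (UNIV :: 'b set) * (card F - dim (UNIV :: 'a set)) < card F"
    using assms cardF by simp
  from exists_linear_prescribed_directions[OF fdb finF spF this, of z]
  obtain A c where A: "linear A" "\<And>x. x \<in> F \<Longrightarrow> A x = c x *\<^sub>R z x" "\<exists>x\<in>F. c x \<noteq> (0::real)"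
    by metis
  \<comment> \<open>Dividing by the largest coefficient keeps \<open>T x + L x\<close> and
    \<open>T x - L x\<close> on the segment between \<open>T x - z x\<close> and
    \<open>T x + z x\<close> for \<open>x\<close> in \<open>F\<close>.\<close>
  define M where "M = Max ((\<lambda>x. \<bar>c x\<bar>) ` F)"
  have M: "\<bar>c x\<bar> \<le> M" if "x \<in> F" for x using that finF by (auto simp: M_def)
  have Mpos: "M > 0" using A(3) M by fastforce
  define L where "L x = (1 / M) *\<^sub>R A x" for x
  have L: "linear L" unfolding L_def using A(1) by (intro linear_compose_scale_right) 
  have Lbound: "norm (T x + L x) \<le> 1 \<and> norm (T x - L x) \<le> 1" if x: "x \<in> ?E" for x
  proof -
    have *: "norm (T y + L y) \<le> 1 \<and> norm (T y - L y) \<le> 1" if y: "y \<in> F" for y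
    proof -
      define r where "r = c y / M"
      have r: "\<bar>r\<bar> \<le> 1" using M[OF y] Mpos by (simp add: r_def)
      have Ly: "L y = r *\<^sub>R z y" using A(2)[OF y] by (simp add: L_def r_def)
      have "norm (T y + s *\<^sub>R z y) \<le> 1" if s: "\<bar>s\<bar> \<le> 1" for s
      proof -
        \<comment> \<open>The weight \<open>(1 + s)/2\<close> maps [-1,1] onto [0,1].\<close>
        have "(1 - (1 + s)/2) *\<^sub>R (T y - z y) + ((1 + s)/2) *\<^sub>R (T y + z y) \<in> cball 0 1"
          using z(2,3)[OF y] s by (intro convexD_alt convex_cball) auto
        moreover have "(1 - (1 + s)/2) *\<^sub>R (T y - z y) + ((1 + s)/2) *\<^sub>R (T y + z y)
          = ((1 - (1 + s)/2) + (1 + s)/2) *\<^sub>R T y + ((1 + s)/2 - (1 - (1 + s)/2)) *\<^sub>R z y"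
          by (simp only: scaleR_left_distrib scaleR_right_distrib scaleR_left_diff_distrib
              scaleR_right_diff_distrib) (simp add: algebra_simps)
        moreover have "\<dots> = T y + s *\<^sub>R z y" by (simp add: field_simps)
        ultimately show ?thesis by simp
      qed
      from this[of r] this[of "- r"] show ?thesis using r Ly by simp
    qed
    from x F(2) consider "x \<in> F" | y where "y \<in> F" "x = - y" by blast
    then show ?thesis
    proof cases
      case 2
      have "T x + L x = - (T y + L y)" "T x - L x = - (T y - L y)"
        using L by (simp_all add: 2 linear_neg blinfun.minus_right)
      then show ?thesis using *[OF 2(1)] by (simp only: norm_minus_cancel)
    qed (use * in blast)
  qed
  have "linear T" by (intro bounded_linear.linear blinfun.bounded_linear_right)
  then have "linear (\<lambda>x. T x + L x)" "linear (\<lambda>x. T x - L x)"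
    using L by (simp_all add: linear_compose_add linear_compose_sub)
  then have N: "norm (T x + L x) \<le> norm x" "norm (T x - L x) \<le> norm x" for x
    using norm_linear_le_of_Ext[OF fda, of _ 1 x] Lbound by force+
  \<comment> \<open>Writing \<open>L\<close> as \<open>(T + L) - T\<close> gives a crude bound,
    enough to turn \<open>L\<close> into a bounded operator.\<close>
  have "norm (L x) \<le> norm x * 2" for x
  proof -
    have "norm (L x) \<le> norm (T x + L x) + norm (T x)"
      using norm_triangle_ineq4[of "T x + L x" "T x"] by simp
    then show ?thesis using N(1)[of x] norm_blinfun[of T x] T(2) by simp
  qed
  then have "bounded_linear L"
    using L by (intro bounded_linear_intro[where K = 2]) (auto simp: linear_add linear_scale)
  then have S: "blinfun_apply (Blinfun L) x = L x" for x by (simp add: bounded_linear_Blinfun_apply)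
  have "norm (T + Blinfun L) \<le> 1" "norm (T - Blinfun L) \<le> 1"
    using N by (auto intro!: norm_blinfun_bound simp: blinfun.add_left blinfun.diff_left S)
  then have "Blinfun L = 0"
    using T extreme_point_of_iff_no_symmetric_segment[OF convex_cball, of T 0 1] by simp
  then have "L x = 0" for x using S[of x] by simp
  \<comment> \<open>At this \<open>x\<close>, \<open>L x\<close> is a nonzero multiple of the
    nonzero vector \<open>z x\<close>.\<close>
  moreover obtain x where "x \<in> F" "c x \<noteq> 0" using A(3) by blast
  ultimately show False using A(2)[of x] z(1)[of x] Mpos by (simp add: L_def)
qed

end
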